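(* Let $L=(L,\cdot)$ be a left quasigroup, $M=(M,\mu)$ a ternary system, and $\pi:L\to M$ a (set-theoretical) bijection. For $\lambda\in L$ let $R^{(L,M,\pi)}(\lambda):L\times L\to L\times L$ be the map $$R^{(L,M,\pi)}(\lambda)(u,v)=\bigl(\eta^{(L,M,\pi)}_\lambda(v)(u),\ \xi^{(L,M,\pi)}_\lambda(u)(v)\bigr)\quad(u,v\in L)$$ defined in the context. Then $R^{(L,M,\pi)}(\lambda)$ is a dynamical Yang-Baxter map associated with $L$, $L$, and $(\cdot)$ if and only if the ternary system $M$ satisfies, for all $a,b,c,d\in M$, $$\mu(a,\mu(a,b,c),\mu(\mu(a,b,c),c,d))=\mu(a,b,\mu(b,c,d)),$$ $$\mu(\mu(a,b,c),c,d)=\mu(\mu(a,b,\mu(b,c,d)),\mu(b,c,d),d).$$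
   Context: A left quasigroup $(L,\cdot)$ is a nonempty set $L$ with a binary operation such that for all $u,w\in L$ there is a unique $v\in L$ with $u\cdot v=w$; this $v$ is denoted $u\backslash_L w$, and $uv$ means $u\cdot v$. A ternary system $(M,\mu)$ is a nonempty set $M$ with a map $\mu:M\times M\times M\to M$. Given $(L,M,\pi)$, for $\lambda,u,v\in L$: $$\xi^{(L,M,\pi)}_\lambda(u)(v)=\lambda\backslash_L\pi^{-1}\bigl(\mu(\pi(\lambda),\pi(\lambda u),\pi((\lambda u)v))\bigr),$$ $$\eta^{(L,M,\pi)}_\lambda(u)(v)=\bigl(\lambda\,\xi^{(L,M,\pi)}_\lambda(v)(u)\bigr)\backslash_L\bigl((\lambda v)u\bigr).$$ Let $H,X$ be nonempty sets and $\phi:H\times X\to H$ a map. A family of maps $R(\lambda):X\times X\to X\times X$ ($\lambda\in H$) is a dynamical Yang-Baxter map associated with $H,X,\phi$ iff for every $\lambda\in H$, on $X\times X\times X$, $$R_{23}(\lambda)R_{13}(\phi(\lambda,X^{(2)}))R_{12}(\lambda)=R_{12}(\phi(\lambda,X^{(3)}))R_{13}(\lambda)R_{23}(\phi(\lambda,X^{(1)})).$$ Here $R_{ij}(\lambda)$ applies $R(\lambda)$ to the $i$-th and $j$-th components and fixes the other one, and $R_{ij}(\phi(\lambda,X^{(k)}))(u_1,u_2,u_3)=R_{ij}(\phi(\lambda,u_k))(u_1,u_2,u_3)$, where $\{i,j,k\}=\{1,2,3\}$ (e.g. $R_{12}(\phi(\lambda,X^{(3)}))(u,v,w)=(R(\phi(\lambda,w))(u,v),w)$).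 In the claim $H=X=L$ and $\phi(\lambda,u)=\lambda\cdot u$. *)

theory Defs
  imports Main
begin

definition left_quasigroup :: "'l set \<Rightarrow> ('l \<Rightarrow> 'l \<Rightarrow> 'l) \<Rightarrow> bool" where
  "left_quasigroup L m \<longleftrightarrow>
     L \<noteq> {} \<and> (\<forall>u\<in>L. \<forall>v\<in>L. m u v \<in> L) \<and> (\<forall>u\<in>L. \<forall>w\<in>L. \<exists>!v. v \<in> L \<and> m u v = w)"

definition left_div :: "'l set \<Rightarrow> ('l \<Rightarrow> 'l \<Rightarrow> 'l) \<Rightarrow> 'l \<Rightarrow> 'l \<Rightarrow> 'l" where
  "left_div L m u w = (THE v. v \<in> L \<and> m u v = w)"

definition ternary_system :: "'m set \<Rightarrow> ('m \<Rightarrow> 'm \<Rightarrow> 'm \<Rightarrow> 'm) \<Rightarrow> bool" where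
  "ternary_system M \<mu> \<longleftrightarrow> M \<noteq> {} \<and> (\<forall>a\<in>M. \<forall>b\<in>M. \<forall>c\<in>M. \<mu> a b c \<in> M)"

text \<open>
  In the following three definitions \<open>\<pi>\<close> is meant to be a bijection from \<open>L\<close> onto the carrier of
  the ternary system, so that \<open>inv_into L \<pi>\<close> is its inverse; that carrier is therefore not an
  argument.
\<close>

definition xi ::
    "'l set \<Rightarrow> ('l \<Rightarrow> 'l \<Rightarrow> 'l) \<Rightarrow> ('m \<Rightarrow> 'm \<Rightarrow> 'm \<Rightarrow> 'm) \<Rightarrow> ('l \<Rightarrow> 'm) \<Rightarrow> 'l \<Rightarrow> 'l \<Rightarrow> 'l \<Rightarrow> 'l" where
  "xi L m \<mu> \<pi> l u v =
     left_div L m l (inv_into L \<pi> (\<mu> (\<pi> l) (\<pi> (m l u)) (\<pi> (m (m l u) v))))"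

definition eta ::
    "'l set \<Rightarrow> ('l \<Rightarrow> 'l \<Rightarrow> 'l) \<Rightarrow> ('m \<Rightarrow> 'm \<Rightarrow> 'm \<Rightarrow> 'm) \<Rightarrow> ('l \<Rightarrow> 'm) \<Rightarrow> 'l \<Rightarrow> 'l \<Rightarrow> 'l \<Rightarrow> 'l" where
  "eta L m \<mu> \<pi> l u v = left_div L m (m l (xi L m \<mu> \<pi> l v u)) (m (m l v) u)"

definition R_map ::
    "'l set \<Rightarrow> ('l \<Rightarrow> 'l \<Rightarrow> 'l) \<Rightarrow> ('m \<Rightarrow> 'm \<Rightarrow> 'm \<Rightarrow> 'm) \<Rightarrow> ('l \<Rightarrow> 'm) \<Rightarrow> 'l \<Rightarrow> 'l \<times> 'l \<Rightarrow> 'l \<times> 'l" where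
  "R_map L m \<mu> \<pi> l = (\<lambda>(u, v). (eta L m \<mu> \<pi> l v u, xi L m \<mu> \<pi> l u v))"

definition act12 :: "('x \<times> 'x \<Rightarrow> 'x \<times> 'x) \<Rightarrow> 'x \<times> 'x \<times> 'x \<Rightarrow> 'x \<times> 'x \<times> 'x" where
  "act12 f = (\<lambda>(u\<^sub>1, u\<^sub>2, u\<^sub>3). let (v\<^sub>1, v\<^sub>2) = f (u\<^sub>1, u\<^sub>2) in (v\<^sub>1, v\<^sub>2, u\<^sub>3))"

definition act13 :: "('x \<times> 'x \<Rightarrow> 'x \<times> 'x) \<Rightarrow> 'x \<times> 'x \<times> 'x \<Rightarrow> 'x \<times> 'x \<times> 'x" where
  "act13 f = (\<lambda>(u\<^sub>1, u\<^sub>2, u\<^sub>3). let (v\<^sub>1, v\<^sub>3) = f (u\<^sub>1, u\<^sub>3) in (v\<^sub>1, u\<^sub>2, v\<^sub>3))"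

definition act23 :: "('x \<times> 'x \<Rightarrow> 'x \<times> 'x) \<Rightarrow> 'x \<times> 'x \<times> 'x \<Rightarrow> 'x \<times> 'x \<times> 'x" where
  "act23 f = (\<lambda>(u\<^sub>1, u\<^sub>2, u\<^sub>3). let (v\<^sub>2, v\<^sub>3) = f (u\<^sub>2, u\<^sub>3) in (u\<^sub>1, v\<^sub>2, v\<^sub>3))"

text \<open>
  \<open>dyn12 R \<phi> l\<close> is $R_{12}(\phi(l, X^{(3)}))$, and similarly for \<open>dyn13\<close> and \<open>dyn23\<close>:
  the parameter is shifted by the component on which \<open>R\<close> does not act.
\<close>

definition dyn12 ::
    "('h \<Rightarrow> 'x \<times> 'x \<Rightarrow> 'x \<times> 'x) \<Rightarrow> ('h \<Rightarrow> 'x \<Rightarrow> 'h) \<Rightarrow> 'h \<Rightarrow> 'x \<times> 'x \<times> 'x \<Rightarrow> 'x \<times> 'x \<times> 'x" where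
  "dyn12 R \<phi> l = (\<lambda>(u\<^sub>1, u\<^sub>2, u\<^sub>3). act12 (R (\<phi> l u\<^sub>3)) (u\<^sub>1, u\<^sub>2, u\<^sub>3))"

definition dyn13 ::
    "('h \<Rightarrow> 'x \<times> 'x \<Rightarrow> 'x \<times> 'x) \<Rightarrow> ('h \<Rightarrow> 'x \<Rightarrow> 'h) \<Rightarrow> 'h \<Rightarrow> 'x \<times> 'x \<times> 'x \<Rightarrow> 'x \<times> 'x \<times> 'x" where
  "dyn13 R \<phi> l = (\<lambda>(u\<^sub>1, u\<^sub>2, u\<^sub>3). act13 (R (\<phi> l u\<^sub>2)) (u\<^sub>1, u\<^sub>2, u\<^sub>3))"

definition dyn23 ::
    "('h \<Rightarrow> 'x \<times> 'x \<Rightarrow> 'x \<times> 'x) \<Rightarrow> ('h \<Rightarrow> 'x \<Rightarrow> 'h) \<Rightarrow> 'h \<Rightarrow> 'x \<times> 'x \<times> 'x \<Rightarrow> 'x \<times> 'x \<times> 'x" where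
  "dyn23 R \<phi> l = (\<lambda>(u\<^sub>1, u\<^sub>2, u\<^sub>3). act23 (R (\<phi> l u\<^sub>1)) (u\<^sub>1, u\<^sub>2, u\<^sub>3))"

text \<open>
  The first four conjuncts express the typing of the data: \<open>H\<close> and \<open>X\<close> are nonempty sets,
  $\phi : H \times X \to H$, and $R(l) : X \times X \to X \times X$ for $l \in H$.
\<close>

definition dynamical_yang_baxter_map ::
    "'h set \<Rightarrow> 'x set \<Rightarrow> ('h \<Rightarrow> 'x \<Rightarrow> 'h) \<Rightarrow> ('h \<Rightarrow> 'x \<times> 'x \<Rightarrow> 'x \<times> 'x) \<Rightarrow> bool" where
  "dynamical_yang_baxter_map H X \<phi> R \<longleftrightarrow>
     H \<noteq> {} \<and> X \<noteq> {} \<and>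
     (\<forall>l\<in>H. \<forall>u\<in>X. \<phi> l u \<in> H) \<and>
     (\<forall>l\<in>H. R l ` (X \<times> X) \<subseteq> X \<times> X) \<and>
     (\<forall>l\<in>H. \<forall>t \<in> X \<times> X \<times> X.
        (act23 (R l) \<circ> dyn13 R \<phi> l \<circ> act12 (R l)) t =
        (dyn12 R \<phi> l \<circ> act13 (R l) \<circ> dyn23 R \<phi> l) t)"

end

theory Submission
  imports Defs
begin

text \<open>
  A parameter \<open>a\<close> together with a tuple of elements of \<open>L\<close> is the same as a walk in \<open>L\<close> that
  starts at \<open>a\<close>: the pair \<open>(u, v)\<close> gives the vertices \<open>a\<close>, \<open>b = a u\<close>, \<open>c = b v\<close>, and left division
  recovers the steps from the vertices. In these coordinates the map \<open>R\<close> at parameter \<open>a\<close> keeps the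
  endpoints \<open>a\<close> and \<open>c\<close> and replaces the middle vertex \<open>b\<close> by \<open>\<mu> a b c\<close>, where \<open>\<mu>\<close> has been carried
  over to \<open>L\<close> along \<open>\<pi>\<close>; the steps of the new walk appear in reversed order, since \<open>R\<close> returns
  \<open>\<eta>\<close> in front of \<open>\<xi>\<close> (lemma \<open>R_map_walk\<close>).

  A triple is a walk with vertices \<open>a\<close>, \<open>b\<close>, \<open>c\<close>, \<open>d\<close>. The shifts of the parameter in the Yang-Baxter
  equation are exactly those for which every factor acts on three consecutive vertices of the
  current walk, so each side changes an inner vertex three times:
  \[ (b, c) \mapsto (p, c) \mapsto (p, q) \mapsto (\mu(a,p,q), q), \qquad
     p = \mu(a,b,c),\; q = \mu(p,c,d), \]
  \[ (b, c) \mapsto (b, r) \mapsto (s, r) \mapsto (s, \mu(s,r,d)), \qquad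
     r = \mu(b,c,d),\; s = \mu(a,b,r). \]
  Equality of the two outcomes is the pair of ternary identities at \<open>a\<close>, \<open>b\<close>, \<open>c\<close>, \<open>d\<close>. Since every
  quadruple of vertices is a walk, the equation for all parameters and triples is equivalent
  to the identities for all quadruples.
\<close>

lemma left_div_closed:
  assumes "left_quasigroup L m" "u \<in> L" "w \<in> L"
  shows "left_div L m u w \<in> L"
proof -
  have "\<exists>!v. v \<in> L \<and> m u v = w"
    using assms by (simp add: left_quasigroup_def)
  from theI'[OF this] show ?thesis by (simp add: left_div_def)
qed

lemma mult_left_div:
  assumes "left_quasigroup L m" "u \<in> L" "w \<in> L"
  shows "m u (left_div L m u w) = w"
proof -
  have "\<exists>!v. v \<in> L \<and> m u v = w"
    using assms by (simp add: left_quasigroup_def)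
  from theI'[OF this] show ?thesis by (simp add: left_div_def)
qed

lemma left_div_mult:
  assumes "left_quasigroup L m" "u \<in> L" "v \<in> L"
  shows "left_div L m u (m u v) = v"
  unfolding left_div_def
  by (rule the1_equality) (use assms in \<open>auto simp: left_quasigroup_def\<close>)

lemma left_div_eq_iff:
  assumes "left_quasigroup L m" "u \<in> L" "w \<in> L" "w' \<in> L"
  shows "left_div L m u w = left_div L m u w' \<longleftrightarrow> w = w'"
  using assms by (metis mult_left_div)

locale ternary_left_quasigroup =
  fixes L :: "'l set" and m :: "'l \<Rightarrow> 'l \<Rightarrow> 'l"
    and M :: "'m set" and \<mu> :: "'m \<Rightarrow> 'm \<Rightarrow> 'm \<Rightarrow> 'm"
    and \<pi> :: "'l \<Rightarrow> 'm"
  assumes left_quasigroup: "left_quasigroup L m"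
    and ternary_system: "ternary_system M \<mu>"
    and bij: "bij_betw \<pi> L M"
begin

abbreviation ld :: "'l \<Rightarrow> 'l \<Rightarrow> 'l" where
  "ld \<equiv> left_div L m"

definition pullback :: "'l \<Rightarrow> 'l \<Rightarrow> 'l \<Rightarrow> 'l" where
  "pullback a b c = inv_into L \<pi> (\<mu> (\<pi> a) (\<pi> b) (\<pi> c))"

abbreviation R :: "'l \<Rightarrow> 'l \<times> 'l \<Rightarrow> 'l \<times> 'l" where
  "R \<equiv> R_map L m \<mu> \<pi>"

lemma mult_closed: "u \<in> L \<Longrightarrow> v \<in> L \<Longrightarrow> m u v \<in> L"
  using left_quasigroup by (simp add: left_quasigroup_def)

lemmas ld_closed = left_div_closed[OF left_quasigroup]
  and mult_ld = mult_left_div[OF left_quasigroup]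
  and ld_mult = left_div_mult[OF left_quasigroup]
  and ld_eq_iff = left_div_eq_iff[OF left_quasigroup]

lemma \<mu>_closed:
  assumes "a \<in> L" "b \<in> L" "c \<in> L"
  shows "\<mu> (\<pi> a) (\<pi> b) (\<pi> c) \<in> M"
  using assms ternary_system bij_betwE[OF bij] by (simp add: ternary_system_def)

lemma pullback_closed:
  assumes "a \<in> L" "b \<in> L" "c \<in> L"
  shows "pullback a b c \<in> L"
  using \<mu>_closed[OF assms] bij_betw_inv_into[OF bij]
  unfolding pullback_def by (auto dest: bij_betwE)

lemma \<pi>_pullback:
  assumes "a \<in> L" "b \<in> L" "c \<in> L"
  shows "\<pi> (pullback a b c) = \<mu> (\<pi> a) (\<pi> b) (\<pi> c)"
  unfolding pullback_def
  by (rule bij_betw_inv_into_right[OF bij \<mu>_closed[OF assms]])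

text \<open>
  \<open>R\<close> replaces the middle vertex: the output steps, read from right to left, form the walk through
  the vertices \<open>a\<close>, \<open>pullback a b c\<close>, \<open>c\<close>.
\<close>

lemma R_map_walk:
  assumes "a \<in> L" "b \<in> L" "c \<in> L"
  shows "R a (ld a b, ld b c) = (ld (pullback a b c) c, ld a (pullback a b c))"
proof -
  have "xi L m \<mu> \<pi> a (ld a b) (ld b c) = ld a (pullback a b c)"
    using assms by (simp add: xi_def pullback_def mult_ld)
  then show ?thesis
    using assms by (simp add: R_map_def eta_def mult_ld pullback_closed)
qed

text \<open>Every pair is the pair of steps of a walk, so \<open>R_map_walk\<close> describes all values of \<open>R\<close>.\<close>

lemma R_map_closed:
  assumes "a \<in> L" "u \<in> L" "v \<in> L"
  shows "R a (u, v) \<in> L \<times> L"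
proof -
  let ?b = "m a u" and ?c = "m (m a u) v"
  have "R a (u, v) = R a (ld a ?b, ld ?b ?c)"
    using assms by (simp add: ld_mult mult_closed)
  also have "\<dots> \<in> L \<times> L"
    using assms by (simp add: R_map_walk mult_closed ld_closed pullback_closed)
  finally show ?thesis .
qed

text \<open>
  In the outputs of both sides the steps again appear in reversed order, so that the inner
  vertices of the resulting walk are read off from the third and second components.
\<close>

lemma yang_baxter_left_walk:
  assumes "a \<in> L" "b \<in> L" "c \<in> L" "d \<in> L"
  defines "p \<equiv> pullback a b c"
  defines "q \<equiv> pullback p c d"
  defines "s \<equiv> pullback a p q"
  shows "(act23 (R a) \<circ> dyn13 R m a \<circ> act12 (R a)) (ld a b, ld b c, ld c d) =
    (ld q d, ld s q, ld a s)"
proof -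
  have "p \<in> L" and "q \<in> L"
    using assms by (simp_all add: pullback_closed)
  with assms(1-4) show ?thesis
    unfolding act12_def act13_def act23_def dyn13_def
    by (simp add: R_map_walk mult_ld flip: p_def q_def s_def)
qed

lemma yang_baxter_right_walk:
  assumes "a \<in> L" "b \<in> L" "c \<in> L" "d \<in> L"
  defines "r \<equiv> pullback b c d"
  defines "s \<equiv> pullback a b r"
  defines "t \<equiv> pullback s r d"
  shows "(dyn12 R m a \<circ> act13 (R a) \<circ> dyn23 R m a) (ld a b, ld b c, ld c d) =
    (ld t d, ld s t, ld a s)"
proof -
  have "r \<in> L" and "s \<in> L"
    using assms by (simp_all add: pullback_closed)
  with assms(1-4) show ?thesis
    unfolding act12_def act13_def act23_def dyn12_def dyn23_def
    by (simp add: R_map_walk mult_ld flip: r_def s_def t_def)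
qed

text \<open>
  A walk is determined by its steps: the third components fix the first inner vertex, and then the
  second components fix the other one.
\<close>

lemma yang_baxter_walk_iff:
  assumes "a \<in> L" "b \<in> L" "c \<in> L" "d \<in> L"
  shows "(act23 (R a) \<circ> dyn13 R m a \<circ> act12 (R a)) (ld a b, ld b c, ld c d) =
      (dyn12 R m a \<circ> act13 (R a) \<circ> dyn23 R m a) (ld a b, ld b c, ld c d) \<longleftrightarrow>
    pullback a (pullback a b c) (pullback (pullback a b c) c d) = pullback a b (pullback b c d) \<and>
    pullback (pullback a b c) c d = pullback (pullback a b (pullback b c d)) (pullback b c d) d"
  unfolding yang_baxter_left_walk[OF assms] yang_baxter_right_walk[OF assms]
  using assms by (auto simp: ld_eq_iff pullback_closed)

lemma triple_as_walk:
  assumes "a \<in> L" "u \<in> L" "v \<in> L" "w \<in> L"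
  obtains b c d where "b \<in> L" "c \<in> L" "d \<in> L" "(u, v, w) = (ld a b, ld b c, ld c d)"
proof
  let ?b = "m a u"
  let ?c = "m ?b v"
  let ?d = "m ?c w"
  show "?b \<in> L" "?c \<in> L" "?d \<in> L" "(u, v, w) = (ld a ?b, ld ?b ?c, ld ?c ?d)"
    using assms by (simp_all add: mult_closed ld_mult)
qed

lemma dynamical_yang_baxter_map_iff_pullback:
  "dynamical_yang_baxter_map L L m R \<longleftrightarrow>
    (\<forall>a\<in>L. \<forall>b\<in>L. \<forall>c\<in>L. \<forall>d\<in>L.
      pullback a (pullback a b c) (pullback (pullback a b c) c d) = pullback a b (pullback b c d) \<and>
      pullback (pullback a b c) c d = pullback (pullback a b (pullback b c d)) (pullback b c d) d)"
  (is "?YB \<longleftrightarrow> ?ids")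
proof -
  have "L \<noteq> {}"
    using left_quasigroup by (simp add: left_quasigroup_def)
  moreover have "\<forall>a\<in>L. R a ` (L \<times> L) \<subseteq> L \<times> L"
    using R_map_closed by blast
  ultimately have "?YB \<longleftrightarrow> (\<forall>a\<in>L. \<forall>t \<in> L \<times> L \<times> L.
      (act23 (R a) \<circ> dyn13 R m a \<circ> act12 (R a)) t =
      (dyn12 R m a \<circ> act13 (R a) \<circ> dyn23 R m a) t)" (is "_ \<longleftrightarrow> ?eq")
    unfolding dynamical_yang_baxter_map_def using mult_closed by blast
  also have "\<dots> \<longleftrightarrow> ?ids"
  proof
    assume eq: ?eq
    show ?ids
    proof (intro ballI)
      fix a b c d
      assume L: "a \<in> L" "b \<in> L" "c \<in> L" "d \<in> L"
      then have "(ld a b, ld b c, ld c d) \<in> L \<times> L \<times> L"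
        by (simp add: ld_closed)
      with eq L(1) have "(act23 (R a) \<circ> dyn13 R m a \<circ> act12 (R a)) (ld a b, ld b c, ld c d) =
          (dyn12 R m a \<circ> act13 (R a) \<circ> dyn23 R m a) (ld a b, ld b c, ld c d)"
        by blast
      then show "pullback a (pullback a b c) (pullback (pullback a b c) c d) =
            pullback a b (pullback b c d) \<and>
          pullback (pullback a b c) c d =
            pullback (pullback a b (pullback b c d)) (pullback b c d) d"
        using yang_baxter_walk_iff[OF L] by blast
    qed
  next
    assume ids: ?ids
    show ?eq
    proof (intro ballI)
      fix a t
      assume a: "a \<in> L" and "t \<in> L \<times> L \<times> L"
      then obtain u v w where t: "t = (u, v, w)" and "u \<in> L" "v \<in> L" "w \<in> L"
        by blast
      with a obtain b c d where L: "b \<in> L" "c \<in> L" "d \<in> L"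
        and walk: "(u, v, w) = (ld a b, ld b c, ld c d)"
        using triple_as_walk by metis
      show "(act23 (R a) \<circ> dyn13 R m a \<circ> act12 (R a)) t =
          (dyn12 R m a \<circ> act13 (R a) \<circ> dyn23 R m a) t"
        unfolding t walk using ids a L yang_baxter_walk_iff by blast
    qed
  qed
  finally show ?thesis .
qed

lemma pullback_identities_iff:
  assumes "a \<in> L" "b \<in> L" "c \<in> L" "d \<in> L"
  shows "pullback a (pullback a b c) (pullback (pullback a b c) c d) =
        pullback a b (pullback b c d) \<and>
      pullback (pullback a b c) c d =
        pullback (pullback a b (pullback b c d)) (pullback b c d) d \<longleftrightarrow>
    \<mu> (\<pi> a) (\<mu> (\<pi> a) (\<pi> b) (\<pi> c)) (\<mu> (\<mu> (\<pi> a) (\<pi> b) (\<pi> c)) (\<pi> c) (\<pi> d)) =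
        \<mu> (\<pi> a) (\<pi> b) (\<mu> (\<pi> b) (\<pi> c) (\<pi> d)) \<and>
      \<mu> (\<mu> (\<pi> a) (\<pi> b) (\<pi> c)) (\<pi> c) (\<pi> d) =
        \<mu> (\<mu> (\<pi> a) (\<pi> b) (\<mu> (\<pi> b) (\<pi> c) (\<pi> d))) (\<mu> (\<pi> b) (\<pi> c) (\<pi> d)) (\<pi> d)"
proof -
  have "x = y \<longleftrightarrow> \<pi> x = \<pi> y" if "x \<in> L" "y \<in> L" for x y
    using inj_on_eq_iff[OF bij_betw_imp_inj_on[OF bij]] that by blast
  \<comment> \<open>Applying \<open>\<pi>\<close> to both sides turns each \<open>pullback\<close> into \<open>\<mu>\<close>, from the outside inwards.\<close>
  then show ?thesis
    using assms by (simp add: pullback_closed \<pi>_pullback)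
qed

end

theorem theorem3p2:
  fixes L :: "'l set" and m :: "'l \<Rightarrow> 'l \<Rightarrow> 'l"
    and M :: "'m set" and \<mu> :: "'m \<Rightarrow> 'm \<Rightarrow> 'm \<Rightarrow> 'm"
    and \<pi> :: "'l \<Rightarrow> 'm"
  assumes "left_quasigroup L m"
    and "ternary_system M \<mu>"
    and "bij_betw \<pi> L M"
  shows "dynamical_yang_baxter_map L L m (R_map L m \<mu> \<pi>) \<longleftrightarrow>
    (\<forall>a\<in>M. \<forall>b\<in>M. \<forall>c\<in>M. \<forall>d\<in>M.
       \<mu> a (\<mu> a b c) (\<mu> (\<mu> a b c) c d) = \<mu> a b (\<mu> b c d) \<and>
       \<mu> (\<mu> a b c) c d = \<mu> (\<mu> a b (\<mu> b c d)) (\<mu> b c d) d)"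
proof -
  interpret ternary_left_quasigroup L m M \<mu> \<pi>
    using assms by unfold_locales
  have M: "M = \<pi> ` L"
    using assms(3) by (simp add: bij_betw_imp_surj_on)
  show ?thesis
    unfolding dynamical_yang_baxter_map_iff_pullback M ball_simps
    by (simp only: pullback_identities_iff cong: ball_cong)
qed

end
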